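(* Let $K$ be a finite simplicial complex, let $\overrightarrow{W}$ be a Morse sequence on $K$, and let $\Upsilon$ be its Morse reference. Then for each $p\ge 0$ and each $c\in K[p]$, we have $d_p(\Upsilon(c))=\Upsilon(\partial_p(c))$.
   Context: A finite simplicial complex $K$ is a finite family of non-empty finite sets such that $\sigma\in K$ whenever $\emptyset\neq\sigma\subseteq\tau$ for some $\tau\in K$; $K^{(p)}$ is the set of $p$-simplexes (sets of $p+1$ elements), and a facet is an inclusion-maximal simplex. For $p\ge -1$, $K[p]$ is the set of all subsets of $K^{(p)}$ (with $K^{(-1)}=\emptyset$, so $K[-1]=\{\emptyset\}$), a $\mathbb{Z}_2$-vector space under symmetric difference, the empty chain being $0$. For $\sigma\in K^{(p)}$, $\partial(\sigma)=\{\tau\in K^{(p-1)}:\tau\subset\sigma\}$; the boundary operator $\partial_p:K[p]\to K[p-1]$ is $\partial_p(c)=\sum_{\sigma\in c}\partial(\sigma)$ (mod 2), $\partial_p(\emptyset)=0$. A pair $(\sigma,\tau)$ with $\sigma\in K^{(p)},\tau\in K^{(p+1)}$ is free for $K$ if $\tau$ is the only simplex of $K$ strictly containing $\sigma$; then $K$ is an elementary expansion of $K\setminus\{\sigma,\tau\}$. If $\sigma$ is a facet of $K$, $K$ is an elementary filling of $K\setminus\{\sigma\}$. A Morse sequence on $K$ is a sequence $\langle\emptyset=K_0,\dots,K_k=K\rangle$ where each $K_i$ is an elementary expansion or elementary filling of $K_{i-1}$; a simplex added by a filling is critical, and a free pair $(\sigma,\tau)$ added by an expansion is a regular pair. $\ddot{W}^{(p)}$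 is the set of critical $p$-simplexes ($\ddot{W}^{(-1)}=\emptyset$) and $\ddot{W}[p]$ the set of its subsets, a subspace of $K[p]$. A Morse frame is a map $\Upsilon$ sending each $\sigma\in K^{(p)}$ to $\Upsilon(\sigma)\in\ddot{W}[p]$, extended to chains by $\Upsilon(c)=\sum_{\sigma\in c}\Upsilon(\sigma)$ (mod 2), $\Upsilon(\emptyset)=0$. The Morse reference $\Upsilon$ is the unique frame with $\Upsilon(\sigma)=\{\sigma\}$ for critical $\sigma$ and, for each regular pair $(\sigma,\tau)$, $\Upsilon(\tau)=0$ and $\Upsilon(\sigma)=\Upsilon(\partial(\tau)\setminus\{\sigma\})$. For a critical $p$-simplex $\sigma$, set $d(\sigma)=\Upsilon(\partial(\sigma))$, and define $d_p:\ddot{W}[p]\to\ddot{W}[p-1]$ by $d_p(c)=\Upsilon(\partial_p(c))=\sum_{\sigma\in c}d(\sigma)$, $d_p(\emptyset)=0$. *)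

theory Defs
  imports Main
begin

section \<open>Finite simplicial complexes and chains modulo 2\<close>

definition finite_complex :: "'a set set \<Rightarrow> bool" where
  "finite_complex K \<longleftrightarrow> finite K \<and> (\<forall>\<sigma>\<in>K. \<sigma> \<noteq> {} \<and> finite \<sigma>) \<and>
     (\<forall>\<tau>\<in>K. \<forall>\<sigma>. \<sigma> \<noteq> {} \<and> \<sigma> \<subseteq> \<tau> \<longrightarrow> \<sigma> \<in> K)"

text \<open>Dimensions are integers, so that dimension \<open>- 1\<close> needs no special treatment:
  simplexes are non-empty, hence \<open>simplexes K (- 1) = {}\<close> and \<open>chain_space K (- 1) = {{}}\<close>.\<close>

definition simplex_dim :: "'a set \<Rightarrow> int" where
  "simplex_dim \<sigma> = int (card \<sigma>) - 1"

definition simplexes :: "'a set set \<Rightarrow> int \<Rightarrow> 'a set set" where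
  "simplexes K p = {\<sigma> \<in> K. simplex_dim \<sigma> = p}"

definition chain_space :: "'a set set \<Rightarrow> int \<Rightarrow> 'a set set set" where
  "chain_space K p = Pow (simplexes K p)"

text \<open>\<open>chain_sum f c\<close> is the sum of the \<open>f \<sigma>\<close>, \<open>\<sigma> \<in> c\<close>, with respect to symmetric
  difference. It is also the extension to chains of a map \<open>f\<close> on simplexes.\<close>

global_interpretation chain_sum: comm_monoid_set sym_diff "{} :: 'b set"
  defines chain_sum = chain_sum.F
  by standard auto

definition face_boundary :: "'a set set \<Rightarrow> 'a set \<Rightarrow> 'a set set" where
  "face_boundary K \<sigma> = {\<tau> \<in> simplexes K (simplex_dim \<sigma> - 1). \<tau> \<subset> \<sigma>}"

text \<open>The boundary operator \<open>\<partial>\<^sub>p\<close> is the restriction of \<open>boundary K\<close> to \<open>chain_space K p\<close>.\<close>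

definition boundary :: "'a set set \<Rightarrow> 'a set set \<Rightarrow> 'a set set" where
  "boundary K c = chain_sum (face_boundary K) c"


section \<open>Morse sequences\<close>

definition free_pair :: "'a set set \<Rightarrow> 'a set \<Rightarrow> 'a set \<Rightarrow> bool" where
  "free_pair K \<sigma> \<tau> \<longleftrightarrow> (\<exists>p. \<sigma> \<in> simplexes K p \<and> \<tau> \<in> simplexes K (p + 1)) \<and>
     {\<rho> \<in> K. \<sigma> \<subset> \<rho>} = {\<tau>}"

definition facet :: "'a set set \<Rightarrow> 'a set \<Rightarrow> bool" where
  "facet K \<sigma> \<longleftrightarrow> \<sigma> \<in> K \<and> (\<forall>\<tau>\<in>K. \<sigma> \<subseteq> \<tau> \<longrightarrow> \<tau> = \<sigma>)"

text \<open>In both steps \<open>L\<close> is the smaller complex and \<open>K\<close> is the larger one.\<close>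

definition expansion_by :: "'a set \<Rightarrow> 'a set \<Rightarrow> 'a set set \<Rightarrow> 'a set set \<Rightarrow> bool" where
  "expansion_by \<sigma> \<tau> L K \<longleftrightarrow> free_pair K \<sigma> \<tau> \<and> L = K - {\<sigma>, \<tau>}"

definition filling_by :: "'a set \<Rightarrow> 'a set set \<Rightarrow> 'a set set \<Rightarrow> bool" where
  "filling_by \<sigma> L K \<longleftrightarrow> facet K \<sigma> \<and> L = K - {\<sigma>}"

definition morse_sequence :: "'a set set \<Rightarrow> 'a set set list \<Rightarrow> bool" where
  "morse_sequence K W \<longleftrightarrow> W \<noteq> [] \<and> hd W = {} \<and> last W = K \<and>
     (\<forall>L\<in>set W. finite_complex L) \<and>
     (\<forall>i. Suc i < length W \<longrightarrow>
        (\<exists>\<sigma> \<tau>. expansion_by \<sigma> \<tau> (W ! i) (W ! Suc i)) \<or>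
        (\<exists>\<sigma>. filling_by \<sigma> (W ! i) (W ! Suc i)))"

definition critical :: "'a set set list \<Rightarrow> 'a set set" where
  "critical W = {\<sigma>. \<exists>i. Suc i < length W \<and> filling_by \<sigma> (W ! i) (W ! Suc i)}"

definition regular_pair :: "'a set set list \<Rightarrow> 'a set \<Rightarrow> 'a set \<Rightarrow> bool" where
  "regular_pair W \<sigma> \<tau> \<longleftrightarrow> (\<exists>i. Suc i < length W \<and> expansion_by \<sigma> \<tau> (W ! i) (W ! Suc i))"


section \<open>Morse frames, the Morse reference and the differential\<close>

text \<open>Values of a frame outside \<open>K\<close> are irrelevant. The critical \<open>p\<close>-chains are
  \<open>chain_space (critical W) p\<close>.\<close>

definition morse_frame :: "'a set set \<Rightarrow> 'a set set list \<Rightarrow> ('a set \<Rightarrow> 'a set set) \<Rightarrow> bool" where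
  "morse_frame K W \<Upsilon> \<longleftrightarrow> (\<forall>p. \<forall>\<sigma>\<in>simplexes K p. \<Upsilon> \<sigma> \<in> chain_space (critical W) p)"

definition morse_reference :: "'a set set \<Rightarrow> 'a set set list \<Rightarrow> ('a set \<Rightarrow> 'a set set) \<Rightarrow> bool" where
  "morse_reference K W \<Upsilon> \<longleftrightarrow> morse_frame K W \<Upsilon> \<and>
     (\<forall>\<sigma>\<in>critical W. \<Upsilon> \<sigma> = {\<sigma>}) \<and>
     (\<forall>\<sigma> \<tau>. regular_pair W \<sigma> \<tau> \<longrightarrow>
        \<Upsilon> \<tau> = {} \<and> \<Upsilon> \<sigma> = chain_sum \<Upsilon> (face_boundary K \<tau> - {\<sigma>}))"

text \<open>The operator \<open>d\<^sub>p\<close> is the restriction of \<open>morse_differential K \<Upsilon>\<close> to the critical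
  \<open>p\<close>-chains.\<close>

definition morse_differential ::
    "'a set set \<Rightarrow> ('a set \<Rightarrow> 'a set set) \<Rightarrow> 'a set set \<Rightarrow> 'a set set" where
  "morse_differential K \<Upsilon> c = chain_sum \<Upsilon> (boundary K c)"


section \<open>Existence and uniqueness of the Morse reference\<close>

lemma chain_sum_in_chain_space:
  assumes "\<And>\<sigma>. \<sigma> \<in> c \<Longrightarrow> f \<sigma> \<in> chain_space C p"
  shows "chain_sum f c \<in> chain_space C p"
  using assms
proof (induction c rule: infinite_finite_induct)
  case (insert x F)
  then have "f x \<in> chain_space C p" "chain_sum f F \<in> chain_space C p" by auto
  then show ?case using insert.hyps by (auto simp: chain_space_def)
qed (auto simp: chain_space_def)

lemma finite_complexD:
  "finite_complex K \<Longrightarrow> \<tau> \<in> K \<Longrightarrow> \<sigma> \<noteq> {} \<Longrightarrow> \<sigma> \<subseteq> \<tau> \<Longrightarrow> \<sigma> \<in> K"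
  unfolding finite_complex_def by metis

lemma face_boundary_subcomplex:
  assumes "finite_complex L" "\<tau> \<in> L" "L \<subseteq> K" "finite_complex K"
  shows "face_boundary K \<tau> = face_boundary L \<tau>"
proof -
  have "\<rho> \<in> L" if "\<rho> \<in> K" "\<rho> \<subset> \<tau>" for \<rho>
  proof -
    have "\<rho> \<noteq> {}" using assms(4) that(1) by (simp add: finite_complex_def)
    then show ?thesis using finite_complexD [OF assms(1,2)] that(2) by blast
  qed
  then show ?thesis using assms(3) unfolding face_boundary_def simplexes_def by blast
qed

lemma step_snoc:
  assumes "W \<noteq> []"
  shows "(\<exists>i. Suc i < length (W @ [K]) \<and> P ((W @ [K]) ! i) ((W @ [K]) ! Suc i)) \<longleftrightarrow>
    (\<exists>i. Suc i < length W \<and> P (W ! i) (W ! Suc i)) \<or> P (last W) K" (is "?l \<longleftrightarrow> ?r")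
proof -
  have W: "(W @ [K]) ! i = W ! i" if "i < length W" for i
    using that by (simp add: nth_append)
  obtain n where n: "length W = Suc n" using assms by (cases W) auto
  have last: "(W @ [K]) ! n = last W" "(W @ [K]) ! Suc n = K"
    using n assms by (simp_all add: nth_append last_conv_nth)
  have "Suc i < length (W @ [K]) \<longleftrightarrow> i < n \<or> i = n" for i
    using n by auto
  then have "?l \<longleftrightarrow> (\<exists>i. (i < n \<or> i = n) \<and> P ((W @ [K]) ! i) ((W @ [K]) ! Suc i))"
    by simp
  also have "\<dots> \<longleftrightarrow> (\<exists>i<n. P ((W @ [K]) ! i) ((W @ [K]) ! Suc i)) \<or> P (last W) K"
    using last by metis
  also have "(\<exists>i<n. P ((W @ [K]) ! i) ((W @ [K]) ! Suc i)) \<longleftrightarrow> (\<exists>i<n. P (W ! i) (W ! Suc i))"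
    using W n by (intro ex_cong1) (metis Suc_less_eq less_SucI)
  finally show ?thesis using n by simp
qed

lemma critical_snoc:
  "W \<noteq> [] \<Longrightarrow> critical (W @ [K]) = critical W \<union> {\<sigma>. filling_by \<sigma> (last W) K}"
  unfolding critical_def Collect_disj_eq [symmetric]
  by (intro Collect_cong step_snoc)

lemma regular_pair_snoc:
  "W \<noteq> [] \<Longrightarrow> regular_pair (W @ [K]) \<sigma> \<tau> \<longleftrightarrow>
     regular_pair W \<sigma> \<tau> \<or> expansion_by \<sigma> \<tau> (last W) K"
  unfolding regular_pair_def by (rule step_snoc)

lemma morse_sequence_snoc:
  assumes "W \<noteq> []" "morse_sequence K' (W @ [K])"
  shows "K' = K" "morse_sequence (last W) W" "finite_complex K" "finite_complex (last W)"
    "(\<exists>\<sigma> \<tau>. expansion_by \<sigma> \<tau> (last W) K) \<or> (\<exists>\<sigma>. filling_by \<sigma> (last W) K)"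
proof -
  let ?P = "\<lambda>x y. (\<exists>\<sigma> \<tau>. expansion_by \<sigma> \<tau> x y) \<or> (\<exists>\<sigma>. filling_by \<sigma> x y)"
  have steps: "\<forall>i. Suc i < length (W @ [K]) \<longrightarrow> ?P ((W @ [K]) ! i) ((W @ [K]) ! Suc i)"
    using assms(2) unfolding morse_sequence_def by blast
  then have "?P (last W) K \<and> (\<forall>i. Suc i < length W \<longrightarrow> ?P (W ! i) (W ! Suc i))"
    using step_snoc [OF assms(1), where P = "\<lambda>x y. \<not> ?P x y" and K = K] by meson
  then show "morse_sequence (last W) W"
    "(\<exists>\<sigma> \<tau>. expansion_by \<sigma> \<tau> (last W) K) \<or> (\<exists>\<sigma>. filling_by \<sigma> (last W) K)"
    using assms unfolding morse_sequence_def by auto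
  show "K' = K" "finite_complex K" "finite_complex (last W)"
    using assms unfolding morse_sequence_def by auto
qed

lemma steps_subset:
  assumes "morse_sequence K W"
  shows "critical W \<subseteq> K \<and> (\<forall>\<sigma> \<tau>. regular_pair W \<sigma> \<tau> \<longrightarrow> \<sigma> \<in> K \<and> \<tau> \<in> K)"
  using assms
proof (induction W arbitrary: K rule: rev_induct)
  case Nil
  then show ?case by (simp add: morse_sequence_def)
next
  case (snoc K' W)
  show ?case
  proof (cases "W = []")
    case True
    then show ?thesis by (simp add: critical_def regular_pair_def)
  next
    case False
    note seq = morse_sequence_snoc [OF False snoc.prems]
    have "last W \<subseteq> K" using seq(1,5) by (auto simp: expansion_by_def filling_by_def)
    then show ?thesis
      using snoc.IH [OF seq(2)] seq(1)
      by (auto simp: critical_snoc [OF False] regular_pair_snoc [OF False]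
          expansion_by_def filling_by_def facet_def free_pair_def simplexes_def)
  qed
qed

lemma expansion_byD:
  assumes "expansion_by \<sigma> \<tau> L K"
  shows "\<sigma> \<subset> \<tau>" "\<sigma> \<in> K" "\<tau> \<in> K" "K - L = {\<sigma>, \<tau>}" "L = K - {\<sigma>, \<tau>}"
    "simplex_dim \<tau> = simplex_dim \<sigma> + 1"
proof -
  have "\<tau> \<in> {\<rho> \<in> K. \<sigma> \<subset> \<rho>}"
    using assms unfolding expansion_by_def free_pair_def by simp
  then show "\<sigma> \<subset> \<tau>" "\<tau> \<in> K" by simp_all
  show dims: "\<sigma> \<in> K" "simplex_dim \<tau> = simplex_dim \<sigma> + 1"
    using assms unfolding expansion_by_def free_pair_def simplexes_def by auto
  show "L = K - {\<sigma>, \<tau>}" using assms unfolding expansion_by_def by simp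
  then show "K - L = {\<sigma>, \<tau>}" using dims(1) \<open>\<tau> \<in> K\<close> by blast
qed

lemma filling_byD:
  assumes "filling_by \<sigma> L K"
  shows "\<sigma> \<in> K" "K - L = {\<sigma>}" "L = K - {\<sigma>}"
  using assms unfolding filling_by_def facet_def by auto

lemma expansion_by_unique:
  assumes "expansion_by \<sigma> \<tau> L K" "expansion_by \<sigma>' \<tau>' L K"
  shows "\<sigma>' = \<sigma> \<and> \<tau>' = \<tau>"
proof -
  have "{\<sigma>, \<tau>} = {\<sigma>', \<tau>'}"
    using expansion_byD(4) [OF assms(1)] expansion_byD(4) [OF assms(2)] by (rule trans [OF sym])
  then show ?thesis
    using expansion_byD(1) [OF assms(1)] expansion_byD(1) [OF assms(2)]
    by (metis doubleton_eq_iff order_less_asym)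
qed

lemma expansion_not_filling:
  assumes "expansion_by \<sigma> \<tau> L K" "filling_by \<rho> L K"
  shows False
proof -
  have "{\<sigma>, \<tau>} = {\<rho>}"
    using expansion_byD(4) [OF assms(1)] filling_byD(2) [OF assms(2)] by (rule trans [OF sym])
  then show False using expansion_byD(1) [OF assms(1)] by auto
qed

theorem morse_reference_exists:
  assumes "morse_sequence K W"
  shows "\<exists>\<Upsilon>. morse_reference K W \<Upsilon>"
  using assms
proof (induction W arbitrary: K rule: rev_induct)
  case Nil
  then show ?case by (simp add: morse_sequence_def)
next
  case (snoc K' W)
  show ?case
  proof (cases "W = []")
    case True
    then show ?thesis using snoc.prems
      by (auto simp: morse_reference_def morse_frame_def morse_sequence_def simplexes_def
          critical_def regular_pair_def)
  next
    case False
    note seq = morse_sequence_snoc [OF False snoc.prems]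
    define L where "L = last W"
    have LK: "L \<subseteq> K" using seq(1,5) by (auto simp: L_def expansion_by_def filling_by_def)
    have fc: "finite_complex K" "finite_complex L" using seq(1,3,4) by (auto simp: L_def)
    obtain \<Upsilon> where ref: "morse_reference L W \<Upsilon>" using snoc.IH [OF seq(2)] L_def by blast
    have frame: "\<Upsilon> \<rho> \<in> chain_space (critical W) (simplex_dim \<rho>)" if "\<rho> \<in> L" for \<rho>
      using ref that by (auto simp: morse_reference_def morse_frame_def simplexes_def)
    have sub: "critical W \<subseteq> L" "\<And>\<sigma> \<tau>. regular_pair W \<sigma> \<tau> \<Longrightarrow> \<sigma> \<in> L \<and> \<tau> \<in> L"
      using steps_subset [OF seq(2)] by (auto simp: L_def)
    have crit: "critical (W @ [K']) = critical W \<union> {\<sigma>. filling_by \<sigma> L K}"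
      using critical_snoc [OF False] seq(1) L_def by simp
    have reg: "regular_pair (W @ [K']) \<sigma> \<tau> \<longleftrightarrow> regular_pair W \<sigma> \<tau> \<or> expansion_by \<sigma> \<tau> L K"
      for \<sigma> \<tau> using regular_pair_snoc [OF False] seq(1) L_def by simp
    have mono: "chain_space (critical W) p \<subseteq> chain_space (critical (W @ [K'])) p" for p
      using crit by (auto simp: chain_space_def simplexes_def)
    have old: "\<Upsilon>' \<tau> = {} \<and> \<Upsilon>' \<sigma> = chain_sum \<Upsilon>' (face_boundary K \<tau> - {\<sigma>})"
      if "regular_pair W \<sigma> \<tau>" and agree: "\<And>\<rho>. \<rho> \<in> L \<Longrightarrow> \<Upsilon>' \<rho> = \<Upsilon> \<rho>" for \<sigma> \<tau> \<Upsilon>'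
    proof -
      have "\<sigma> \<in> L" "\<tau> \<in> L" using sub that by auto
      have "face_boundary K \<tau> = face_boundary L \<tau>"
        using face_boundary_subcomplex fc LK \<open>\<tau> \<in> L\<close> by blast
      moreover have "face_boundary L \<tau> \<subseteq> L" by (auto simp: face_boundary_def simplexes_def)
      ultimately have "chain_sum \<Upsilon>' (face_boundary K \<tau> - {\<sigma>}) =
          chain_sum \<Upsilon> (face_boundary L \<tau> - {\<sigma>})"
        using agree by (intro chain_sum.cong) auto
      then show ?thesis using ref that(1) agree \<open>\<sigma> \<in> L\<close> \<open>\<tau> \<in> L\<close>
        by (simp add: morse_reference_def)
    qed
    consider (exp) \<sigma> \<tau> where "expansion_by \<sigma> \<tau> L K" | (fill) \<sigma> where "filling_by \<sigma> L K"
      using seq(1,5) L_def by blast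
    then show ?thesis
    proof cases
      case fill
      define \<Upsilon>' where "\<Upsilon>' = \<Upsilon>(\<sigma> := {\<sigma>})"
      have \<sigma>: "\<sigma> \<in> K" "L = K - {\<sigma>}" using filling_byD [OF fill] by auto
      then have agree: "\<And>\<rho>. \<rho> \<in> L \<Longrightarrow> \<Upsilon>' \<rho> = \<Upsilon> \<rho>" by (auto simp: \<Upsilon>'_def)
      have "\<rho> = \<sigma>" if "filling_by \<rho> L K" for \<rho>
        using filling_byD(2) [OF that] filling_byD(2) [OF fill] by simp
      then have uniq: "{\<rho>. filling_by \<rho> L K} = {\<sigma>}"
        using fill by blast
      have crit': "critical (W @ [K']) = critical W \<union> {\<sigma>}" using crit uniq by simp
      have "morse_frame K (W @ [K']) \<Upsilon>'"
        unfolding morse_frame_def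
      proof (intro allI ballI)
        fix p \<rho> assume "\<rho> \<in> simplexes K p"
        then have \<rho>: "\<rho> \<in> K" "simplex_dim \<rho> = p" by (auto simp: simplexes_def)
        show "\<Upsilon>' \<rho> \<in> chain_space (critical (W @ [K'])) p"
        proof (cases "\<rho> = \<sigma>")
          case True
          then show ?thesis using \<rho> crit' by (auto simp: \<Upsilon>'_def chain_space_def simplexes_def)
        next
          case False
          then have "\<rho> \<in> L" using \<rho> \<sigma> by simp
          then show ?thesis using frame [of \<rho>] agree [of \<rho>] mono \<rho> by auto
        qed
      qed
      moreover have "\<forall>\<rho>\<in>critical (W @ [K']). \<Upsilon>' \<rho> = {\<rho>}"
        using crit' ref by (auto simp: \<Upsilon>'_def morse_reference_def)
      moreover have "\<forall>a b. regular_pair (W @ [K']) a b \<longrightarrow>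
          \<Upsilon>' b = {} \<and> \<Upsilon>' a = chain_sum \<Upsilon>' (face_boundary K b - {a})"
        using reg old [OF _ agree] expansion_not_filling [OF _ fill] by metis
      ultimately show ?thesis unfolding morse_reference_def by blast
    next
      case exp
      define s where "s = chain_sum \<Upsilon> (face_boundary K \<tau> - {\<sigma>})"
      define \<Upsilon>' where "\<Upsilon>' = \<Upsilon>(\<sigma> := s, \<tau> := {})"
      have \<sigma>: "\<sigma> \<in> K" "\<tau> \<in> K" "L = K - {\<sigma>, \<tau>}" "\<sigma> \<subset> \<tau>" "simplex_dim \<tau> = simplex_dim \<sigma> + 1"
        using expansion_byD [OF exp] by auto
      then have agree: "\<And>\<rho>. \<rho> \<in> L \<Longrightarrow> \<Upsilon>' \<rho> = \<Upsilon> \<rho>" by (auto simp: \<Upsilon>'_def)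
      have crit': "critical (W @ [K']) = critical W"
        using crit expansion_not_filling [OF exp] by blast
      have bd: "face_boundary K \<tau> - {\<sigma>} \<subseteq> simplexes L (simplex_dim \<sigma>)"
        using \<sigma> by (auto simp: face_boundary_def simplexes_def)
      have s: "s \<in> chain_space (critical W) (simplex_dim \<sigma>)"
        unfolding s_def using bd frame by (intro chain_sum_in_chain_space) (force simp: simplexes_def)
      have s': "chain_sum \<Upsilon>' (face_boundary K \<tau> - {\<sigma>}) = s"
        unfolding s_def using bd agree
        by (intro chain_sum.cong) (auto simp: simplexes_def)
      have "morse_frame K (W @ [K']) \<Upsilon>'"
        unfolding morse_frame_def
      proof (intro allI ballI)
        fix p \<rho> assume "\<rho> \<in> simplexes K p"
        then have \<rho>: "\<rho> \<in> K" "simplex_dim \<rho> = p" by (auto simp: simplexes_def)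
        consider "\<rho> = \<tau>" | "\<rho> = \<sigma>" | "\<rho> \<in> L" using \<rho> \<sigma> by blast
        then show "\<Upsilon>' \<rho> \<in> chain_space (critical (W @ [K'])) p"
        proof cases
          case 1
          then show ?thesis by (simp add: \<Upsilon>'_def chain_space_def)
        next
          case 2
          then show ?thesis using s \<rho> \<sigma>(4) crit' by (auto simp: \<Upsilon>'_def)
        next
          case 3
          then show ?thesis using frame [of \<rho>] agree [of \<rho>] mono \<rho> by auto
        qed
      qed
      moreover have "\<forall>\<rho>\<in>critical (W @ [K']). \<Upsilon>' \<rho> = {\<rho>}"
        using crit' ref sub agree by (auto simp: morse_reference_def)
      moreover have "\<Upsilon>' \<tau> = {} \<and> \<Upsilon>' \<sigma> = chain_sum \<Upsilon>' (face_boundary K \<tau> - {\<sigma>})"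
        using s' \<sigma>(4) by (auto simp: \<Upsilon>'_def)
      then have "\<forall>a b. regular_pair (W @ [K']) a b \<longrightarrow>
          \<Upsilon>' b = {} \<and> \<Upsilon>' a = chain_sum \<Upsilon>' (face_boundary K b - {a})"
        using reg old [OF _ agree] expansion_by_unique [OF exp] by metis
      ultimately show ?thesis unfolding morse_reference_def by blast
    qed
  qed
qed

theorem morse_reference_unique:
  assumes seq: "morse_sequence K W"
    and ref: "morse_reference K W \<Upsilon>" "morse_reference K W \<Upsilon>'"
    and "\<rho> \<in> K"
  shows "\<Upsilon> \<rho> = \<Upsilon>' \<rho>"
proof -
  have "\<forall>\<rho>\<in>W ! i. \<Upsilon> \<rho> = \<Upsilon>' \<rho>" if "i < length W" for i
    using that
  proof (induction i)
    case 0
    then show ?case using seq by (auto simp: morse_sequence_def hd_conv_nth)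
  next
    case (Suc i)
    let ?L = "W ! i" and ?M = "W ! Suc i"
    have IH: "\<forall>\<rho>\<in>?L. \<Upsilon> \<rho> = \<Upsilon>' \<rho>" using Suc by simp
    have M: "finite_complex ?M" using seq Suc.prems by (auto simp: morse_sequence_def)
    consider (exp) \<sigma> \<tau> where "expansion_by \<sigma> \<tau> ?L ?M" | (fill) \<sigma> where "filling_by \<sigma> ?L ?M"
      using seq Suc.prems unfolding morse_sequence_def by blast
    then show ?case
    proof cases
      case fill
      then have "\<sigma> \<in> critical W" using Suc.prems by (auto simp: critical_def)
      then have "\<Upsilon> \<sigma> = \<Upsilon>' \<sigma>" using ref by (simp add: morse_reference_def)
      then show ?thesis using filling_byD(3) [OF fill] IH by auto
    next
      case exp
      then have "regular_pair W \<sigma> \<tau>" using Suc.prems by (auto simp: regular_pair_def)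
      then have eqs: "\<Upsilon> \<tau> = {}" "\<Upsilon>' \<tau> = {}"
          "\<Upsilon> \<sigma> = chain_sum \<Upsilon> (face_boundary K \<tau> - {\<sigma>})"
          "\<Upsilon>' \<sigma> = chain_sum \<Upsilon>' (face_boundary K \<tau> - {\<sigma>})"
        using ref unfolding morse_reference_def by simp_all
      have L: "?L = ?M - {\<sigma>, \<tau>}" "\<tau> \<in> ?M"
        using expansion_byD [OF exp] by auto
      have fc: "finite_complex K" using seq by (auto simp: morse_sequence_def)
      have "face_boundary K \<tau> - {\<sigma>} \<subseteq> ?L"
      proof
        fix \<rho> assume "\<rho> \<in> face_boundary K \<tau> - {\<sigma>}"
        then have \<rho>: "\<rho> \<in> K" "\<rho> \<subset> \<tau>" "\<rho> \<noteq> \<sigma>"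
          by (auto simp: face_boundary_def simplexes_def)
        then have "\<rho> \<noteq> {}" using fc by (simp add: finite_complex_def)
        then have "\<rho> \<in> ?M" using finite_complexD [OF M L(2)] \<rho>(2) by blast
        then show "\<rho> \<in> ?L" using \<rho> L(1) by auto
      qed
      then have "\<Upsilon> \<sigma> = \<Upsilon>' \<sigma>"
        unfolding eqs using IH by (intro chain_sum.cong) auto
      then show ?thesis using eqs(1,2) IH expansion_byD(5) [OF exp]
        by (metis Diff_iff insertE singletonD)
    qed
  qed
  moreover have "K = W ! (length W - 1)" "length W - 1 < length W"
    using seq by (auto simp: morse_sequence_def last_conv_nth)
  ultimately show ?thesis using \<open>\<rho> \<in> K\<close> by blast
qed

end

theory Submission
  imports Defs
begin

text \<open>By linearity it suffices to compare both sides on a single simplex, by induction along the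
  Morse sequence. For a critical simplex there is nothing to show. For a regular pair \<open>(\<sigma>, \<tau>)\<close>,
  the equation \<open>\<Upsilon> \<sigma> = \<Upsilon> (\<partial> \<tau> - {\<sigma>})\<close> says that \<open>\<Upsilon> (\<partial> \<tau>) = 0\<close>, which is the claim for \<open>\<tau>\<close>;
  and \<open>\<partial> (\<partial> \<tau>) = 0\<close> gives \<open>\<partial> \<sigma> = \<partial> (\<partial> \<tau> - {\<sigma>})\<close>, so that the claim for \<open>\<sigma>\<close> reduces to the
  claim for the other faces of \<open>\<tau>\<close>, all of which occur earlier in the sequence.\<close>

lemma finite_chain_sum:
  "(\<And>x. x \<in> A \<Longrightarrow> finite (f x)) \<Longrightarrow> finite (chain_sum f A)"
  by (induction A rule: infinite_finite_induct) auto

text \<open>Splitting both chains along \<open>A \<inter> B\<close>, the common part contributes the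
  same summand twice, which cancels modulo 2.\<close>

lemma chain_sum_sym_diff:
  assumes "finite A" "finite B"
  shows "chain_sum f (sym_diff A B) = sym_diff (chain_sum f A) (chain_sum f B)"
proof -
  have split: "chain_sum f S = sym_diff (chain_sum f (S - T)) (chain_sum f (S \<inter> T))"
    if "finite S" for S T
  proof -
    have "chain_sum f (S - T \<union> S \<inter> T) = sym_diff (chain_sum f (S - T)) (chain_sum f (S \<inter> T))"
      using that by (intro chain_sum.union_disjoint) auto
    then show ?thesis by (simp only: Un_Diff_Int)
  qed
  have "chain_sum f (sym_diff A B) = sym_diff (chain_sum f (A - B)) (chain_sum f (B - A))"
    using assms by (intro chain_sum.union_disjoint) auto
  then show ?thesis
    using split [OF assms(1), of B] split [OF assms(2), of A] by (simp only: Int_commute) blast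
qed

text \<open>Composition of linear extensions, by induction on \<open>A\<close> with additivity of
  the outer sum. Finiteness matters because \<open>chain_sum\<close> over an infinite set is
  \<open>{}\<close> by default.\<close>

lemma chain_sum_chain_sum:
  assumes "finite A" "\<And>x. x \<in> A \<Longrightarrow> finite (g x)"
  shows "chain_sum f (chain_sum g A) = chain_sum (\<lambda>x. chain_sum f (g x)) A"
  using assms
proof (induction A)
  case (insert x A)
  then show ?case using chain_sum_sym_diff [of "g x" "chain_sum g A" f]
    by (simp add: finite_chain_sum)
qed simp

text \<open>This turns the vanishing of a chain modulo 2 into a parity count.\<close>

lemma mem_chain_sum_iff:
  assumes "finite A"
  shows "y \<in> chain_sum f A \<longleftrightarrow> odd (card {x \<in> A. y \<in> f x})"
  using assms
proof (induction A)
  case (insert x A)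
  have "{z \<in> insert x A. y \<in> f z} =
      (if y \<in> f x then insert x {z \<in> A. y \<in> f z} else {z \<in> A. y \<in> f z})"
    by auto
  then show ?case using insert by auto
qed simp

lemma finite_face_boundary: "finite K \<Longrightarrow> finite (face_boundary K \<sigma>)"
  by (simp add: face_boundary_def simplexes_def)

lemma mem_face_boundary_iff:
  assumes "finite_complex K" "\<tau> \<in> K"
  shows "\<sigma> \<in> face_boundary K \<tau> \<longleftrightarrow> \<sigma> \<in> K \<and> \<sigma> \<subseteq> \<tau> \<and> card \<tau> = Suc (card \<sigma>)"
  using assms by (auto simp: face_boundary_def simplexes_def simplex_dim_def)

text \<open>A simplex of codimension 2 in \<open>\<tau>\<close> lies in exactly two facets of the
  boundary of \<open>\<tau>\<close>, so it is counted twice; any other simplex is counted zero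
  times.\<close>

lemma boundary_face_boundary:
  assumes K: "finite_complex K" and \<tau>: "\<tau> \<in> K"
  shows "chain_sum (face_boundary K) (face_boundary K \<tau>) = {}"
proof -
  have fin: "finite K" "\<And>\<sigma>. \<sigma> \<in> K \<Longrightarrow> finite \<sigma>" using K by (auto simp: finite_complex_def)
  have "even (card {\<sigma> \<in> face_boundary K \<tau>. \<rho> \<in> face_boundary K \<sigma>})" (is "even (card ?S)") for \<rho>
  proof (cases "?S = {}")
    case False
    have S: "?S = {\<sigma> \<in> K. \<rho> \<in> K \<and> \<rho> \<subseteq> \<sigma> \<and> \<sigma> \<subseteq> \<tau> \<and> card \<tau> = Suc (card \<sigma>) \<and> card \<sigma> = Suc (card \<rho>)}"
      using mem_face_boundary_iff [OF K] \<tau> by blast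
    then have \<rho>: "\<rho> \<in> K" "\<rho> \<subseteq> \<tau>" "card \<tau> = Suc (Suc (card \<rho>))" using False by auto
    \<comment> \<open>The simplexes between \<open>\<rho>\<close> and \<open>\<tau>\<close> arise by
      adding one of the two missing vertices; closure of \<open>K\<close> under non-empty subsets
      ensures that both results are in \<open>K\<close>.\<close>
    have "?S = (\<lambda>a. insert a \<rho>) ` (\<tau> - \<rho>)"
    proof (intro equalityI subsetI)
      fix \<sigma> assume "\<sigma> \<in> ?S"
      then have \<sigma>: "\<rho> \<subseteq> \<sigma>" "\<sigma> \<subseteq> \<tau>" "card \<sigma> = Suc (card \<rho>)" unfolding S by auto
      then have "card (\<sigma> - \<rho>) = 1" using fin(2) [OF \<rho>(1)] by (simp add: card_Diff_subset)
      then obtain a where "\<sigma> - \<rho> = {a}" by (auto simp: card_1_singleton_iff)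
      then show "\<sigma> \<in> (\<lambda>a. insert a \<rho>) ` (\<tau> - \<rho>)" using \<sigma> by blast
    next
      fix \<sigma> assume "\<sigma> \<in> (\<lambda>a. insert a \<rho>) ` (\<tau> - \<rho>)"
      then obtain a where a: "a \<in> \<tau>" "a \<notin> \<rho>" "\<sigma> = insert a \<rho>" by blast
      then have "\<sigma> \<in> K" using finite_complexD [OF K \<tau>] \<rho>(2) by auto
      then show "\<sigma> \<in> ?S" unfolding S using a \<rho> fin by auto
    qed
    moreover have "inj_on (\<lambda>a. insert a \<rho>) (\<tau> - \<rho>)" by (auto simp: inj_on_def)
    moreover have "card (\<tau> - \<rho>) = 2" using \<rho> fin by (simp add: card_Diff_subset)
    ultimately show ?thesis by (simp add: card_image)
  next
    case True
    then show ?thesis by (simp only: card.empty even_zero)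
  qed
  then show ?thesis
    by (simp add: set_eq_iff mem_chain_sum_iff [OF finite_face_boundary [OF fin(1)]])
qed

lemma morse_differential_simplex:
  assumes K: "finite_complex K" and seq: "morse_sequence K W"
    and ref: "morse_reference K W \<Upsilon>" and "\<rho> \<in> K"
  shows "chain_sum (\<lambda>\<sigma>. chain_sum \<Upsilon> (face_boundary K \<sigma>)) (\<Upsilon> \<rho>) = chain_sum \<Upsilon> (face_boundary K \<rho>)"
proof -
  define D where "D = (\<lambda>\<sigma>. chain_sum \<Upsilon> (face_boundary K \<sigma>))"
  have finK: "finite K" using K by (simp add: finite_complex_def)
  have fin\<Upsilon>: "finite (\<Upsilon> \<sigma>)" if "\<sigma> \<in> K" for \<sigma>
  proof -
    have "\<Upsilon> \<sigma> \<subseteq> critical W"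
      using ref that by (auto simp: morse_reference_def morse_frame_def chain_space_def simplexes_def)
    then show ?thesis using steps_subset [OF seq] finK by (meson finite_subset)
  qed
  \<comment> \<open>Only the range of \<open>\<rho>\<close> grows with \<open>i\<close>:
    \<open>\<Upsilon>\<close> and the boundaries inside \<open>D\<close> always refer to the whole
    of \<open>K\<close>. The start is the empty complex.\<close>
  have "\<forall>\<rho>\<in>W ! i. chain_sum D (\<Upsilon> \<rho>) = D \<rho>" if "i < length W" for i
    using that
  proof (induction i)
    case 0
    then show ?case using seq by (auto simp: morse_sequence_def hd_conv_nth)
  next
    case (Suc i)
    let ?L = "W ! i" and ?M = "W ! Suc i"
    have IH: "\<And>\<rho>. \<rho> \<in> ?L \<Longrightarrow> chain_sum D (\<Upsilon> \<rho>) = D \<rho>" using Suc by simp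
    have M: "finite_complex ?M" using seq Suc.prems by (auto simp: morse_sequence_def)
    consider (exp) \<sigma> \<tau> where "expansion_by \<sigma> \<tau> ?L ?M" | (fill) \<sigma> where "filling_by \<sigma> ?L ?M"
      using seq Suc.prems unfolding morse_sequence_def by blast
    then show ?case
    proof cases
      case fill
      then have "\<Upsilon> \<sigma> = {\<sigma>}" using ref Suc.prems by (auto simp: critical_def morse_reference_def)
      then have "chain_sum D (\<Upsilon> \<sigma>) = D \<sigma>" by simp
      then show ?thesis using filling_byD(3) [OF fill] IH by auto
    next
      case exp
      let ?F = "face_boundary K \<tau> - {\<sigma>}"
      have "regular_pair W \<sigma> \<tau>" using exp Suc.prems by (auto simp: regular_pair_def)
      then have \<Upsilon>: "\<Upsilon> \<tau> = {}" "\<Upsilon> \<sigma> = chain_sum \<Upsilon> ?F" and \<sigma>\<tau>: "\<sigma> \<in> K" "\<tau> \<in> K"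
        using ref steps_subset [OF seq] unfolding morse_reference_def by auto
      note e = expansion_byD [OF exp]
      \<comment> \<open>The faces of \<open>\<tau>\<close> lie in \<open>?M\<close>, which is a
        complex; those other than \<open>\<sigma>\<close> are neither of the two added simplexes,
        hence are already in \<open>?L\<close>.\<close>
      have F: "?F \<subseteq> ?L" "?F \<subseteq> K"
      proof -
        have "\<rho> \<in> ?M" "\<rho> \<noteq> \<tau>" if "\<rho> \<in> ?F" for \<rho>
        proof -
          have \<rho>: "\<rho> \<in> K" "\<rho> \<subset> \<tau>" using that by (auto simp: face_boundary_def simplexes_def)
          then have "\<rho> \<noteq> {}" using K by (simp add: finite_complex_def)
          then show "\<rho> \<in> ?M" "\<rho> \<noteq> \<tau>" using finite_complexD [OF M e(3)] \<rho>(2) by blast+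
        qed
        then show "?F \<subseteq> ?L" unfolding e(5) by blast
        show "?F \<subseteq> K" by (auto simp: face_boundary_def simplexes_def)
      qed
      have finF: "finite ?F" using finite_face_boundary [OF finK] by simp
      have "\<sigma> \<in> face_boundary K \<tau>"
        using e(1,6) \<sigma>\<tau> by (simp add: face_boundary_def simplexes_def)
      then have remove: "chain_sum f (face_boundary K \<tau>) = sym_diff (f \<sigma>) (chain_sum f ?F)"
        for f :: "'a set \<Rightarrow> 'a set set"
        using finite_face_boundary [OF finK] by (rule chain_sum.remove [rotated])
      \<comment> \<open>\<open>remove\<close> with \<open>f = \<Upsilon>\<close>: the two summands
        agree by the reference equation and cancel.\<close>
      have "D \<tau> = {}" unfolding D_def remove using \<Upsilon>(2) by simp
      then have \<tau>: "chain_sum D (\<Upsilon> \<tau>) = D \<tau>" using \<Upsilon>(1) by simp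
      \<comment> \<open>\<open>remove\<close> with \<open>f = face_boundary K\<close>: a symmetric
        difference is empty only if its two sides are equal.\<close>
      have "face_boundary K \<sigma> = chain_sum (face_boundary K) ?F"
        using boundary_face_boundary [OF K \<sigma>\<tau>(2)] unfolding remove by blast
      then have "D \<sigma> = chain_sum D ?F"
        unfolding D_def using chain_sum_chain_sum [OF finF] finite_face_boundary [OF finK] by metis
      also have "\<dots> = chain_sum (\<lambda>\<rho>. chain_sum D (\<Upsilon> \<rho>)) ?F"
        using F IH by (intro chain_sum.cong) auto
      also have "\<dots> = chain_sum D (\<Upsilon> \<sigma>)"
        unfolding \<Upsilon>(2) using finF F(2) fin\<Upsilon> by (intro chain_sum_chain_sum [symmetric]) auto
      finally show ?thesis using \<tau> IH e(5) by auto
    qed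
  qed
  moreover have "K = W ! (length W - 1)" "length W - 1 < length W"
    using seq by (auto simp: morse_sequence_def last_conv_nth)
  ultimately show ?thesis using \<open>\<rho> \<in> K\<close> unfolding D_def by blast
qed

theorem theorem2:
  fixes K :: "'a set set" and W :: "'a set set list"
    and \<Upsilon> :: "'a set \<Rightarrow> 'a set set" and p :: int and c :: "'a set set"
  assumes "finite_complex K"
    and "morse_sequence K W"
    and "morse_reference K W \<Upsilon>"
    and "p \<ge> 0"
    and "c \<in> chain_space K p"
  shows "morse_differential K \<Upsilon> (chain_sum \<Upsilon> c) = chain_sum \<Upsilon> (boundary K c)"
proof -
  define D where "D = (\<lambda>\<sigma>. chain_sum \<Upsilon> (face_boundary K \<sigma>))"
  have c: "c \<subseteq> K" and finK: "finite K"
    using assms(1,5) by (auto simp: chain_space_def simplexes_def finite_complex_def)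
  then have finc: "finite c" using finite_subset by blast
  have "critical W \<subseteq> K" using steps_subset [OF assms(2)] by simp
  then have "\<Upsilon> \<sigma> \<subseteq> K" if "\<sigma> \<in> c" for \<sigma>
    using assms(3) c that
    by (fastforce simp: morse_reference_def morse_frame_def chain_space_def simplexes_def)
  then have fin\<Upsilon>: "finite (\<Upsilon> \<sigma>)" if "\<sigma> \<in> c" for \<sigma>
    using that finK finite_subset by blast
  \<comment> \<open>\<open>\<Upsilon>\<close> after the boundary is the linear extension of
    \<open>D\<close>; both sides of the goal have this shape, with \<open>b\<close> taken to be
    \<open>chain_sum \<Upsilon> c\<close> and \<open>c\<close>.\<close>
  have D: "chain_sum \<Upsilon> (boundary K b) = chain_sum D b" if "finite b" for b
    unfolding boundary_def D_def
    using that finite_face_boundary [OF finK] by (rule chain_sum_chain_sum)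
  have "morse_differential K \<Upsilon> (chain_sum \<Upsilon> c) = chain_sum D (chain_sum \<Upsilon> c)"
    unfolding morse_differential_def using fin\<Upsilon> by (intro D finite_chain_sum)
  also have "\<dots> = chain_sum (\<lambda>\<sigma>. chain_sum D (\<Upsilon> \<sigma>)) c"
    using finc fin\<Upsilon> by (rule chain_sum_chain_sum)
  also have "\<dots> = chain_sum D c"
    using morse_differential_simplex [OF assms(1-3)] c unfolding D_def
    by (intro chain_sum.cong [OF refl]) blast
  also have "\<dots> = chain_sum \<Upsilon> (boundary K c)" using D [OF finc] by simp
  finally show ?thesis .
qed

end
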